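(* Let $X$ be a Tychonoff space. Then $C_p(X)$ is Ascoli if and only if $X$ has the property $(\kappa)$.
   Context: $C_p(X)$ (respectively $C_k(X)$) denotes the space $C(X)$ of all real-valued continuous functions on a Tychonoff space $X$ endowed with the topology of pointwise convergence (respectively, the compact-open topology). A Tychonoff space $Y$ is called an Ascoli space if every compact subset $\mathcal{K}$ of $C_k(Y)$ is evenly continuous, i.e., the map $(f,y)\mapsto f(y)$ is continuous as a map from $\mathcal{K}\times Y$ to $\mathbb{R}$. A family $\{A_i\}_{i\in I}$ of subsets of a set $X$ is point-finite if the set $\{i\in I: x\in A_i\}$ is finite for every $x\in X$. A family $\{A_i\}_{i\in I}$ of subsets of a topological space $X$ is strongly point-finite if for every $i\in I$ there exists an open set $U_i$ of $X$ such that $A_i\subseteq U_i$ and the family $\{U_i\}_{i\in I}$ is point-finite. A topological space $X$ has the property $(\kappa)$ if every sequence of pairwise disjoint finite subsets of $X$ has a strongly point-finite subsequence. *)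

theory Defs
  imports "HOL-Analysis.Analysis"
begin

definition tychonoff_space :: "'a topology \<Rightarrow> bool" where
  "tychonoff_space X \<longleftrightarrow> completely_regular_space X \<and> Hausdorff_space X"

text \<open>
  The set \<open>C(X)\<close>. A continuous function on the carrier of \<open>X\<close> is represented by its unique
  extensional representative (value \<^term>\<open>undefined\<close> outside the carrier), as in the library's
  \<^const>\<open>product_topology\<close>.
\<close>

definition real_cfuns :: "'a topology \<Rightarrow> ('a \<Rightarrow> real) set" where
  "real_cfuns X = {f \<in> extensional (topspace X). continuous_map X euclideanreal f}"

definition Cp :: "'a topology \<Rightarrow> ('a \<Rightarrow> real) topology" where
  "Cp X = subtopology (product_topology (\<lambda>_. euclideanreal) (topspace X)) (real_cfuns X)"

definition Ck :: "'a topology \<Rightarrow> ('a \<Rightarrow> real) topology" where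
  "Ck X = topology_generated_by
     {{f \<in> real_cfuns X. f ` K \<subseteq> U} | K U. compactin X K \<and> open U}"

lemma topspace_Cp: "topspace (Cp X) = real_cfuns X"
  by (auto simp: Cp_def real_cfuns_def PiE_def)

lemma topspace_Ck: "topspace (Ck X) = real_cfuns X"
proof
  show "topspace (Ck X) \<subseteq> real_cfuns X"
    unfolding Ck_def topology_generated_by_topspace by blast
  show "real_cfuns X \<subseteq> topspace (Ck X)"
    unfolding Ck_def topology_generated_by_topspace
    by (rule Union_upper, rule CollectI, rule exI[of _ "{}"], rule exI[of _ UNIV]) simp
qed

definition evenly_continuous :: "'a topology \<Rightarrow> ('a \<Rightarrow> real) set \<Rightarrow> bool" where
  "evenly_continuous Y \<K> \<longleftrightarrow>
     continuous_map (prod_topology (subtopology (Ck Y) \<K>) Y) euclideanreal (\<lambda>(f, y). f y)"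

definition Ascoli_space :: "'a topology \<Rightarrow> bool" where
  "Ascoli_space Y \<longleftrightarrow>
     tychonoff_space Y \<and> (\<forall>\<K>. compactin (Ck Y) \<K> \<longrightarrow> evenly_continuous Y \<K>)"

definition point_finite :: "'a set \<Rightarrow> 'i set \<Rightarrow> ('i \<Rightarrow> 'a set) \<Rightarrow> bool" where
  "point_finite S I A \<longleftrightarrow> (\<forall>x\<in>S. finite {i \<in> I. x \<in> A i})"

definition strongly_point_finite :: "'a topology \<Rightarrow> 'i set \<Rightarrow> ('i \<Rightarrow> 'a set) \<Rightarrow> bool" where
  "strongly_point_finite X I A \<longleftrightarrow>
     (\<exists>U. (\<forall>i\<in>I. openin X (U i) \<and> A i \<subseteq> U i) \<and> point_finite (topspace X) I U)"

text \<open>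
  Disjointness is indexed: \<open>A m\<close> and \<open>A n\<close> are disjoint whenever \<open>m \<noteq> n\<close>.
\<close>

definition property_kappa :: "'a topology \<Rightarrow> bool" where
  "property_kappa X \<longleftrightarrow>
     (\<forall>A :: nat \<Rightarrow> 'a set.
        (\<forall>n. finite (A n) \<and> A n \<subseteq> topspace X) \<and> disjoint_family A \<longrightarrow>
        (\<exists>r :: nat \<Rightarrow> nat. strict_mono r \<and> strongly_point_finite X UNIV (A \<circ> r)))"

end

theory Submission
  imports Defs
begin

text \<open>
  Both directions pass through test sequences. If \<open>X\<close> has \<open>(\<kappa>)\<close>, then every point in the closure of
  an open \<open>U \<subseteq> C\<^sub>p(X)\<close> is the limit of a sequence in \<open>U\<close>: membership in \<open>U\<close> near a function is decided
  on a finite set, and \<open>(\<kappa>)\<close> allows functions in \<open>U\<close> to be modified, off the finite sets that matter,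
  so as to converge pointwise. A compact \<open>\<K> \<subseteq> C\<^sub>k(Y)\<close> is evenly continuous along convergent
  sequences, hence evenly continuous when \<open>Y\<close> has this sequential property. Conversely, for pairwise
  disjoint finite \<open>A\<^sub>n\<close> without a strongly point-finite subsequence, continuous functions \<open>\<Phi>\<^sub>n\<close> on
  \<open>C\<^sub>p(X)\<close> that vanish unless \<open>f > n\<close> on \<open>A\<^sub>n\<close>, and are \<open>1\<close> where \<open>f \<ge> n + 1\<close> on \<open>A\<^sub>n\<close>, converge to
  \<open>0\<close> in the compact-open topology, but not evenly at \<open>0\<close>.
\<close>

text \<open>Weaker than the Frechet-Urysohn property: sequences need only reach the closures of open
  sets. The equicontinuity argument below applies it to an open set of points where some member of
  \<open>K\<close> oscillates.\<close>

definition kappa_Frechet_Urysohn :: "'a topology \<Rightarrow> bool" where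
  "kappa_Frechet_Urysohn Y \<longleftrightarrow>
     (\<forall>U y. openin Y U \<and> y \<in> Y closure_of U \<longrightarrow>
        (\<exists>\<sigma>::nat \<Rightarrow> 'a. range \<sigma> \<subseteq> U \<and> limitin Y \<sigma> y sequentially))"

subsection \<open>Compact sets of functions on \<open>\<kappa>\<close>-Frechet--Urysohn spaces\<close>

text \<open>Otherwise each point of \<open>K\<close> has a neighbourhood visited by finitely many
  indices only, and a finite subcover would leave only finitely many indices altogether. The cluster
  point need not be the limit of a subsequence.\<close>

lemma compactin_sequence_cluster_point:
  fixes f :: "nat \<Rightarrow> 'a"
  assumes K: "compactin Z K" and f: "range f \<subseteq> K"
  obtains g where "g \<in> K" "\<And>W. openin Z W \<Longrightarrow> g \<in> W \<Longrightarrow> infinite {n. f n \<in> W}"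
proof (rule ccontr)
  assume "\<not> thesis"
  with that have "\<forall>g\<in>K. \<exists>W. openin Z W \<and> g \<in> W \<and> finite {n. f n \<in> W}"
    by blast
  then obtain W where W: "\<And>g. g \<in> K \<Longrightarrow> openin Z (W g) \<and> g \<in> W g \<and> finite {n. f n \<in> W g}"
    by metis
  have "(\<forall>U\<in>W ` K. openin Z U) \<and> K \<subseteq> \<Union>(W ` K)"
    using W by blast
  then obtain \<F> where \<F>: "finite \<F>" "\<F> \<subseteq> W ` K" "K \<subseteq> \<Union>\<F>"
    using K unfolding compactin_def by meson
  have "f n \<in> \<Union>\<F>" for n
    using f \<F>(3) by blast
  then have "(\<Union>U\<in>\<F>. {n. f n \<in> U}) = UNIV"
    by auto
  moreover have "finite (\<Union>U\<in>\<F>. {n. f n \<in> U})"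
  proof (rule finite_UN_I[OF \<F>(1)])
    fix U assume "U \<in> \<F>"
    then obtain g where "g \<in> K" "U = W g"
      using \<F>(2) by blast
    then show "finite {n. f n \<in> U}"
      using W by simp
  qed
  ultimately show False
    by simp
qed

lemma openin_Ck_subbasic:
  assumes "compactin Y C" "open U"
  shows "openin (Ck Y) {f \<in> real_cfuns Y. f ` C \<subseteq> U}"
  unfolding Ck_def using assms by (intro topology_generated_by_Basis) blast

text \<open>If this fails, a sequence \<open>\<sigma>\<close> tends to \<open>y0\<close> while some
  \<open>f n\<close> in \<open>K\<close> changes by more than \<open>\<epsilon>\<close> between
  \<open>y0\<close> and \<open>\<sigma> n\<close>. A cluster point \<open>g\<close> of these
  functions is continuous, so it is nearly constant on \<open>y0\<close> and a tail of
  \<open>\<sigma>\<close>; this set is compact, so some \<open>f n\<close> is nearly constant there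
  too.\<close>

lemma compactin_Ck_equicontinuous:
  assumes Y: "kappa_Frechet_Urysohn Y" and K: "compactin (Ck Y) K"
    and y0: "y0 \<in> topspace Y" and "\<epsilon> > 0"
  obtains V where "openin Y V" "y0 \<in> V" "\<And>f y. f \<in> K \<Longrightarrow> y \<in> V \<Longrightarrow> \<bar>f y - f y0\<bar> \<le> \<epsilon>"
proof (rule ccontr)
  assume neg: "\<not> thesis"
  have KC: "K \<subseteq> real_cfuns Y"
    using K compactin_subset_topspace topspace_Ck by blast
  \<comment> \<open>The non-strict bound in the conclusion makes its failure an open condition,
    hence \<open>U\<close> is open.\<close>
  define U where "U = (\<Union>f\<in>K. {y \<in> topspace Y. f y - f y0 \<in> - {-\<epsilon>..\<epsilon>}})"
  have "openin Y {y \<in> topspace Y. f y - f y0 \<in> - {-\<epsilon>..\<epsilon>}}" if "f \<in> K" for f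
  proof (rule openin_continuous_map_preimage)
    show "continuous_map Y euclideanreal (\<lambda>y. f y - f y0)"
      using that KC by (intro continuous_intros) (auto simp: real_cfuns_def)
    show "openin euclideanreal (- {-\<epsilon>..\<epsilon>})"
      by (simp add: open_Compl)
  qed
  then have "openin Y U"
    unfolding U_def by blast
  moreover have "y0 \<in> Y closure_of U"
    unfolding in_closure_of
  proof (intro conjI allI impI y0)
    fix T assume T: "y0 \<in> T \<and> openin Y T"
    with neg that obtain f y where "f \<in> K" "y \<in> T" "\<not> \<bar>f y - f y0\<bar> \<le> \<epsilon>"
      by blast
    moreover from this T have "y \<in> topspace Y"
      using openin_subset by blast
    ultimately show "\<exists>y. y \<in> U \<and> y \<in> T"
      unfolding U_def by (intro exI[of _ y] conjI UN_I[of f]) auto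
  qed
  ultimately obtain \<sigma> :: "nat \<Rightarrow> 'a" where \<sigma>: "range \<sigma> \<subseteq> U" and lim: "limitin Y \<sigma> y0 sequentially"
    using Y unfolding kappa_Frechet_Urysohn_def by blast
  have "\<forall>n. \<exists>f\<in>K. \<not> \<bar>f (\<sigma> n) - f y0\<bar> \<le> \<epsilon>"
    using \<sigma> unfolding U_def by (force simp: abs_le_iff)
  then obtain f where f: "\<And>n. f n \<in> K" "\<And>n. \<not> \<bar>f n (\<sigma> n) - f n y0\<bar> \<le> \<epsilon>"
    by metis
  then have "range f \<subseteq> K"
    by blast
  then obtain g where g: "g \<in> K"
    and cluster: "\<And>W. openin (Ck Y) W \<Longrightarrow> g \<in> W \<Longrightarrow> infinite {n. f n \<in> W}"
    using compactin_sequence_cluster_point[OF K] by metis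
  define B where "B = ball (g y0) (\<epsilon> / 2)"
  have contg: "continuous_map Y euclideanreal g"
    using g KC by (auto simp: real_cfuns_def)
  have "limitin euclideanreal (g \<circ> \<sigma>) (g y0) sequentially"
    using continuous_map_limit[OF contg lim] .
  then have "eventually (\<lambda>n. g (\<sigma> n) \<in> B) sequentially"
    using \<open>\<epsilon> > 0\<close> unfolding B_def
    by (auto simp: limitin_def simp del: limitin_canonical_iff mem_ball)
  then obtain N where N: "\<And>n. n \<ge> N \<Longrightarrow> g (\<sigma> n) \<in> B"
    unfolding eventually_sequentially by blast
  define C where "C = insert y0 (\<sigma> ` {N..})"
  have "compactin Y C"
    unfolding C_def
  proof (rule compactin_sequence_with_limit[OF lim])
    show "\<sigma> ` {N..} \<subseteq> topspace Y"
      using \<sigma> \<open>openin Y U\<close> openin_subset by blast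
  qed auto
  then have "openin (Ck Y) {h \<in> real_cfuns Y. h ` C \<subseteq> B}"
    by (rule openin_Ck_subbasic) (simp add: B_def)
  moreover have "g ` C \<subseteq> B"
    using N \<open>\<epsilon> > 0\<close> by (auto simp: C_def) (simp add: B_def)
  \<comment> \<open>Infinitude provides an index beyond \<open>N\<close>, so that
    \<open>\<sigma> n\<close> itself lies in \<open>C\<close>.\<close>
  ultimately have "infinite {n. f n \<in> {h \<in> real_cfuns Y. h ` C \<subseteq> B}}"
    using g KC by (intro cluster) auto
  then obtain n where n: "n \<ge> N" "f n ` C \<subseteq> B"
    unfolding infinite_nat_iff_unbounded_le by blast
  then have "f n (\<sigma> n) \<in> B" "f n y0 \<in> B"
    by (auto simp: C_def)
  then have "\<bar>g y0 - f n (\<sigma> n)\<bar> < \<epsilon> / 2" "\<bar>g y0 - f n y0\<bar> < \<epsilon> / 2"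
    by (simp_all add: B_def dist_real_def)
  then have "\<bar>f n (\<sigma> n) - f n y0\<bar> \<le> \<epsilon>"
    by linarith
  then show False
    using f by blast
qed

text \<open>Equicontinuity at \<open>y0\<close> controls the point variable uniformly over
  \<open>K\<close>, and closeness at the single point \<open>y0\<close> controls the function
  variable; each costs \<open>\<epsilon> / 2\<close>.\<close>

lemma kappa_Frechet_Urysohn_imp_evenly_continuous:
  assumes Y: "kappa_Frechet_Urysohn Y" and K: "compactin (Ck Y) K"
  shows "evenly_continuous Y K"
proof -
  let ?P = "prod_topology (subtopology (Ck Y) K) Y"
  \<comment> \<open>\<open>Met_TC.mtopology\<close> is the Euclidean topology of the reals; in this
    form the metric criterion for continuity applies.\<close>
  have "continuous_map ?P Met_TC.mtopology (\<lambda>(f, y). f y)"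
    unfolding Met_TC.continuous_map_to_metric
  proof (intro ballI allI impI)
    fix p and \<epsilon> :: real
    assume p: "p \<in> topspace ?P" and "\<epsilon> > 0"
    then obtain f0 y0 where p_def: "p = (f0, y0)" and f0: "f0 \<in> K" "f0 \<in> real_cfuns Y"
      and y0: "y0 \<in> topspace Y"
      by (cases p) (auto simp: topspace_Ck)
    from \<open>\<epsilon> > 0\<close> have "\<epsilon> / 2 > 0"
      by simp
    then obtain V where V: "openin Y V" "y0 \<in> V"
      "\<And>f y. f \<in> K \<Longrightarrow> y \<in> V \<Longrightarrow> \<bar>f y - f y0\<bar> \<le> \<epsilon> / 2"
      using compactin_Ck_equicontinuous[OF Y K y0] by blast
    define W where "W = {f \<in> real_cfuns Y. f ` {y0} \<subseteq> ball (f0 y0) (\<epsilon> / 2)}"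
    have "openin (Ck Y) W"
      unfolding W_def using y0 by (intro openin_Ck_subbasic) auto
    then have "openin ?P ((K \<inter> W) \<times> V)"
      using V by (intro openin_prod_Times_iff[THEN iffD2] disjI2 conjI)
        (auto simp: openin_subtopology_Int2)
    moreover have "p \<in> (K \<inter> W) \<times> V"
      using f0 V \<open>\<epsilon> > 0\<close> by (auto simp: p_def W_def)
    moreover have "(case q of (f, y) \<Rightarrow> f y) \<in> Met_TC.mball (case p of (f, y) \<Rightarrow> f y) \<epsilon>"
      if q_in: "q \<in> (K \<inter> W) \<times> V" for q
    proof -
      obtain f y where q: "q = (f, y)" "f \<in> K" "f \<in> W" "y \<in> V"
        using q_in by blast
      have "\<bar>f y - f y0\<bar> \<le> \<epsilon> / 2" "\<bar>f0 y0 - f y0\<bar> < \<epsilon> / 2"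
        using q V by (auto simp: W_def dist_real_def)
      then have "\<bar>f0 y0 - f y\<bar> < \<epsilon>"
        by linarith
      then show ?thesis
        by (simp add: q p_def dist_real_def)
    qed
    ultimately show "\<exists>U. openin ?P U \<and> p \<in> U \<and>
      (\<forall>q\<in>U. (case q of (f, y) \<Rightarrow> f y) \<in> Met_TC.mball (case p of (f, y) \<Rightarrow> f y) \<epsilon>)"
      by blast
  qed
  then show ?thesis
    by (simp add: evenly_continuous_def)
qed

subsection \<open>The topology of pointwise convergence\<close>

lemma tychonoff_space_Cp: "tychonoff_space (Cp X)"
  by (auto simp: tychonoff_space_def Cp_def Hausdorff_space_product_topology
      completely_regular_space_product_topology
      metrizable_imp_completely_regular_space[OF metrizable_space_euclidean]
      intro!: completely_regular_space_subtopology Hausdorff_space_subtopology)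

lemma continuous_map_Cp_eval:
  "x \<in> topspace X \<Longrightarrow> continuous_map (Cp X) euclideanreal (\<lambda>f. f x)"
  unfolding Cp_def by (intro continuous_intros)

lemma restrict_in_real_cfuns:
  "continuous_map X euclideanreal f \<Longrightarrow> restrict f (topspace X) \<in> real_cfuns X"
  by (auto simp: real_cfuns_def elim: continuous_map_eq)

lemma limitin_Cp:
  assumes "\<And>n. \<sigma> n \<in> real_cfuns X" "f \<in> real_cfuns X"
    and "\<And>x. x \<in> topspace X \<Longrightarrow> (\<lambda>n. \<sigma> n x) \<longlonglongrightarrow> f x"
  shows "limitin (Cp X) \<sigma> f sequentially"
  using assms by (auto simp: Cp_def limitin_subtopology limitin_componentwise real_cfuns_def PiE_def)

text \<open>A basic box of the product topology constrains finitely many coordinates only; these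
  form \<open>F\<close>.\<close>

lemma openin_Cp_determined_finite:
  assumes W: "openin (Cp X) W" and f: "f \<in> W"
  obtains F where "finite F" "F \<subseteq> topspace X"
    "\<And>g. g \<in> real_cfuns X \<Longrightarrow> (\<And>x. x \<in> F \<Longrightarrow> g x = f x) \<Longrightarrow> g \<in> W"
proof -
  obtain T where T: "openin (product_topology (\<lambda>_. euclideanreal) (topspace X)) T"
    and W_eq: "W = T \<inter> real_cfuns X"
    using W unfolding Cp_def openin_subtopology by blast
  then obtain U where U: "finite {x \<in> topspace X. U x \<noteq> (UNIV :: real set)}"
    "f \<in> Pi\<^sub>E (topspace X) U" "Pi\<^sub>E (topspace X) U \<subseteq> T"
    using f unfolding openin_product_topology_alt by force
  show thesis
  proof
    fix g
    assume g: "g \<in> real_cfuns X" and eq: "\<And>x. x \<in> {x \<in> topspace X. U x \<noteq> UNIV} \<Longrightarrow> g x = f x"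
    have "g x \<in> U x" if "x \<in> topspace X" for x
      using that eq[of x] U(2) by (cases "U x = UNIV") auto
    then have "g \<in> Pi\<^sub>E (topspace X) U"
      using g by (simp add: real_cfuns_def PiE_iff)
    then show "g \<in> W"
      using U g W_eq by blast
  qed (use U in auto)
qed

lemma openin_Cp_neighbourhood:
  assumes E: "finite E" "E \<subseteq> topspace X"
  shows "openin (Cp X) {f \<in> real_cfuns X. \<forall>x\<in>E. \<bar>f x - y x\<bar> < \<delta>}"
proof -
  have "openin (Cp X) {f \<in> topspace (Cp X). f x \<in> ball (y x) \<delta>}" if "x \<in> E" for x
    using that E by (intro openin_continuous_map_preimage[OF continuous_map_Cp_eval]) auto
  then have "openin (Cp X) (topspace (Cp X) \<inter> (\<Inter>x\<in>E. {f \<in> topspace (Cp X). f x \<in> ball (y x) \<delta>}))"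
    using E by (cases "E = {}") (auto intro!: openin_INT2)
  also have "topspace (Cp X) \<inter> (\<Inter>x\<in>E. {f \<in> topspace (Cp X). f x \<in> ball (y x) \<delta>}) =
      {f \<in> real_cfuns X. \<forall>x\<in>E. \<bar>f x - y x\<bar> < \<delta>}"
    by (auto simp: topspace_Cp dist_real_def abs_minus_commute)
  finally show ?thesis .
qed

lemma tychonoff_finite_separation:
  assumes X: "tychonoff_space X" and A: "finite A" "A \<subseteq> topspace X" and S: "closedin X S" "A \<inter> S = {}"
  obtains \<phi> :: "'a \<Rightarrow> real" where "continuous_map X euclideanreal \<phi>"
    "\<And>x. x \<in> A \<Longrightarrow> \<phi> x = 1" "\<And>x. x \<in> S \<Longrightarrow> \<phi> x = 0"
proof -
  have "completely_regular_space X" "compactin X A" "disjnt A S"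
    using X A S by (auto simp: tychonoff_space_def finite_imp_compactin disjnt_def)
  from Urysohn_completely_regular_compact_closed_alt[OF this(1,2) S(1) this(3)]
  obtain \<phi> :: "'a \<Rightarrow> real" where "continuous_map X euclideanreal \<phi>" "\<phi> ` S \<subseteq> {0}" "\<phi> ` A \<subseteq> {1}"
    by metis
  then show thesis
    using that by blast
qed

text \<open>With \<open>c\<close> the difference \<open>f - y\<close> clipped to
  \<open>{-\<delta>..\<delta>}\<close>, the function \<open>h\<close> interpolates between
  \<open>f\<close> (where \<open>\<phi>\<close> is 1) and \<open>y + c\<close> (where
  \<open>\<phi>\<close> is 0). Where \<open>f\<close> is already \<open>\<delta>\<close>-close to
  \<open>y\<close>, clipping changes nothing and \<open>h\<close> equals \<open>f\<close> whatever
  \<open>\<phi>\<close> is.\<close>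

lemma Cp_truncate_outside:
  assumes X: "tychonoff_space X" and f: "f \<in> real_cfuns X" and y: "y \<in> real_cfuns X"
    and A: "finite A" "A \<subseteq> V" and V: "openin X V" and "\<delta> > 0"
  obtains h where "h \<in> real_cfuns X"
    "\<And>x. x \<in> topspace X \<Longrightarrow> x \<in> A \<or> \<bar>f x - y x\<bar> < \<delta> \<Longrightarrow> h x = f x"
    "\<And>x. x \<in> topspace X - V \<Longrightarrow> \<bar>h x - y x\<bar> \<le> \<delta>"
proof -
  obtain \<phi> :: "'a \<Rightarrow> real" where \<phi>: "continuous_map X euclideanreal \<phi>"
    "\<And>x. x \<in> A \<Longrightarrow> \<phi> x = 1" "\<And>x. x \<in> topspace X - V \<Longrightarrow> \<phi> x = 0"
    using tychonoff_finite_separation[OF X, of A "topspace X - V"] A V openin_subset[OF V] by blast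
  define c where "c x = max (-\<delta>) (min \<delta> (f x - y x))" for x
  define h where "h = (\<lambda>x\<in>topspace X. y x + c x + \<phi> x * (f x - y x - c x))"
  show thesis
  proof
    have "continuous_map X euclideanreal (\<lambda>x. y x + c x + \<phi> x * (f x - y x - c x))"
      using f y \<phi> unfolding c_def real_cfuns_def by (auto intro!: continuous_intros)
    then show "h \<in> real_cfuns X"
      unfolding h_def by (rule restrict_in_real_cfuns)
    show "h x = f x" if "x \<in> topspace X" "x \<in> A \<or> \<bar>f x - y x\<bar> < \<delta>" for x
      using that by (auto simp: h_def \<phi> c_def)
    show "\<bar>h x - y x\<bar> \<le> \<delta>" if "x \<in> topspace X - V" for x
      using that \<open>\<delta> > 0\<close> by (auto simp: h_def \<phi> c_def)
  qed
qed

subsection \<open>The property \<open>(\<kappa>)\<close> and function spaces\<close>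

text \<open>Functions \<open>p n\<close> in \<open>U\<close> are chosen ever closer to
  \<open>y\<close> on growing finite sets \<open>E n\<close>. Their membership in \<open>U\<close>
  is decided on finite sets \<open>G n\<close>, whose new parts \<open>A n\<close> are pairwise
  disjoint. Applying \<open>(\<kappa>)\<close> to these parts yields neighbourhoods
  \<open>V k\<close> off which \<open>p (r k)\<close> can be pulled towards \<open>y\<close> without
  leaving \<open>U\<close>.\<close>

lemma property_kappa_imp_kappa_Frechet_Urysohn_Cp:
  assumes X: "tychonoff_space X" and \<kappa>: "property_kappa X"
  shows "kappa_Frechet_Urysohn (Cp X)"
  unfolding kappa_Frechet_Urysohn_def
proof (intro allI impI)
  fix U y
  assume "openin (Cp X) U \<and> y \<in> Cp X closure_of U"
  then have U: "openin (Cp X) U" and y: "y \<in> Cp X closure_of U"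
    by auto
  have UC: "U \<subseteq> real_cfuns X"
    using openin_subset[OF U] by (simp add: topspace_Cp)
  have yC: "y \<in> real_cfuns X"
    using y by (simp add: in_closure_of topspace_Cp)
  \<comment> \<open>\<open>F\<close> is a finite set on which agreement with \<open>f\<close> forces
    membership in \<open>U\<close>.\<close>
  define P where "P E n f F \<longleftrightarrow>
      f \<in> U \<and> finite F \<and> F \<subseteq> topspace X \<and> (\<forall>x\<in>E. \<bar>f x - y x\<bar> < 1 / Suc n) \<and>
      (\<forall>g\<in>real_cfuns X. (\<forall>x\<in>F. g x = f x) \<longrightarrow> g \<in> U)" for E F f and n :: nat
  have "\<exists>f F. P E n f F"
    if E: "finite E" "E \<subseteq> topspace X" for E and n :: nat
  proof -
    let ?B = "{f \<in> real_cfuns X. \<forall>x\<in>E. \<bar>f x - y x\<bar> < 1 / Suc n}"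
    have "y \<in> ?B \<and> openin (Cp X) ?B"
      using yC openin_Cp_neighbourhood[OF E] by simp
    then have "\<exists>f. f \<in> U \<and> f \<in> ?B"
      using y unfolding in_closure_of by (elim conjE allE[of _ ?B] impE) auto
    then obtain f where f: "f \<in> U" "\<forall>x\<in>E. \<bar>f x - y x\<bar> < 1 / Suc n"
      by blast
    obtain F where F: "finite F" "F \<subseteq> topspace X"
      "\<And>g. g \<in> real_cfuns X \<Longrightarrow> (\<And>x. x \<in> F \<Longrightarrow> g x = f x) \<Longrightarrow> g \<in> U"
      using openin_Cp_determined_finite[OF U f(1)] by metis
    have "P E n f F"
      unfolding P_def using f F by simp
    then show ?thesis
      by blast
  qed
  then obtain f F where fF: "\<And>E n. finite E \<Longrightarrow> E \<subseteq> topspace X \<Longrightarrow> P E n (f E n) (F E n)"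
    by metis
  \<comment> \<open>\<open>E n\<close> collects the deciding sets of all earlier stages, so the next
    function is close to \<open>y\<close> on all of them.\<close>
  define E where "E = rec_nat {} (\<lambda>n E. E \<union> F E n)"
  have E_simps: "E 0 = {}" "\<And>n. E (Suc n) = E n \<union> F (E n) n"
    by (auto simp: E_def)
  have E: "finite (E n) \<and> E n \<subseteq> topspace X" for n
  proof (induction n)
    case (Suc n)
    then have "P (E n) n (f (E n) n) (F (E n) n)"
      using fF by blast
    then show ?case
      using Suc by (simp add: E_simps P_def)
  qed (simp add: E_simps)
  define p where "p n = f (E n) n" for n
  define G where "G n = F (E n) n" for n
  have pGP: "P (E n) n (p n) (G n)" for n
    using fF E by (simp add: p_def G_def)
  then have pG: "\<And>n. p n \<in> U" "\<And>n. finite (G n)" "\<And>n. G n \<subseteq> topspace X"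
    "\<And>n x. x \<in> E n \<Longrightarrow> \<bar>p n x - y x\<bar> < 1 / Suc n"
    unfolding P_def by simp_all
  have G_det: "g \<in> U" if "g \<in> real_cfuns X" "\<And>x. x \<in> G n \<Longrightarrow> g x = p n x" for g n
    using pGP[of n] that unfolding P_def by simp
  have E_Suc: "E (Suc n) = E n \<union> G n" for n
    by (simp add: E_simps G_def)
  have E_mono: "E m \<subseteq> E n" if "m \<le> n" for m n
    using that by (rule lift_Suc_mono_le[of E, rotated]) (simp add: E_Suc)
  define A where "A n = G n - E n" for n
  have A: "finite (A n) \<and> A n \<subseteq> topspace X" for n
    using pG(2,3)[of n] by (auto simp: A_def)
  have "A m \<inter> A n = {}" if "m < n" for m n
    using E_mono[of "Suc m" n] that by (auto simp: A_def E_Suc)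
  then have "disjoint_family A"
    by (metis disjoint_family_on_def inf_commute nat_neq_iff)
  with A \<kappa> obtain r :: "nat \<Rightarrow> nat" where r: "strict_mono r"
    and "strongly_point_finite X UNIV (A \<circ> r)"
    unfolding property_kappa_def by blast
  then obtain V where V: "\<And>k. openin X (V k)" "\<And>k. A (r k) \<subseteq> V k"
    and V_pf: "\<And>x. x \<in> topspace X \<Longrightarrow> finite {k. x \<in> V k}"
    unfolding strongly_point_finite_def point_finite_def by auto
  have "\<exists>h\<in>U. \<forall>x\<in>topspace X - V k. \<bar>h x - y x\<bar> \<le> 1 / Suc (r k)" for k
  proof -
    have pk: "p (r k) \<in> real_cfuns X"
      using pG(1) UC by blast
    have fin: "finite (A (r k))" and pos: "0 < 1 / real (Suc (r k))"
      using A by auto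
    obtain h where h: "h \<in> real_cfuns X"
      "\<And>x. x \<in> topspace X \<Longrightarrow> x \<in> A (r k) \<or> \<bar>p (r k) x - y x\<bar> < 1 / Suc (r k) \<Longrightarrow> h x = p (r k) x"
      "\<And>x. x \<in> topspace X - V k \<Longrightarrow> \<bar>h x - y x\<bar> \<le> 1 / Suc (r k)"
      using Cp_truncate_outside[OF X pk yC fin V(2)[of k] V(1) pos] by metis
    \<comment> \<open>A point of \<open>G (r k)\<close> is either new, hence in
      \<open>A (r k)\<close>, or in \<open>E (r k)\<close>, where \<open>p (r k)\<close> is already
      close to \<open>y\<close>. Both cases leave the value unchanged.\<close>
    have "h x = p (r k) x" if "x \<in> G (r k)" for x
      using that pG(3)[of "r k"] pG(4)[of x "r k"] by (intro h(2)) (auto simp: A_def)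
    then have "h \<in> U"
      using G_det h(1) by blast
    then show ?thesis
      using h(3) by blast
  qed
  then obtain \<sigma> where \<sigma>: "\<And>k. \<sigma> k \<in> U"
    "\<And>k x. x \<in> topspace X - V k \<Longrightarrow> \<bar>\<sigma> k x - y x\<bar> \<le> 1 / Suc (r k)"
    by metis
  have "limitin (Cp X) \<sigma> y sequentially"
  proof (rule limitin_Cp)
    fix x assume x: "x \<in> topspace X"
    \<comment> \<open>Point-finiteness puts \<open>x\<close> outside almost all \<open>V k\<close>,
      where the truncation bound holds.\<close>
    have "eventually (\<lambda>k. k \<notin> {k. x \<in> V k}) sequentially"
      using V_pf[OF x] by (metis cofinite_eq_sequentially eventually_cofinite mem_Collect_eq not_not Collect_cong)
    then have "eventually (\<lambda>k. norm (\<sigma> k x - y x) \<le> 1 / Suc k) sequentially"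
    proof eventually_elim
      case (elim k)
      then have "\<bar>\<sigma> k x - y x\<bar> \<le> 1 / Suc (r k)"
        using \<sigma>(2) x by blast
      also have "\<dots> \<le> 1 / Suc k"
        using seq_suble[OF r, of k] by (simp add: field_simps)
      finally show ?case
        by simp
    qed
    then have "(\<lambda>k. \<sigma> k x - y x) \<longlonglongrightarrow> 0"
      by (rule Lim_null_comparison) (use LIMSEQ_inverse_real_of_nat in \<open>simp add: inverse_eq_divide\<close>)
    then show "(\<lambda>k. \<sigma> k x) \<longlonglongrightarrow> y x"
      by (simp add: LIM_zero_iff)
  qed (use \<sigma> UC yC in auto)
  then show "\<exists>\<sigma>. range \<sigma> \<subseteq> U \<and> limitin (Cp X) \<sigma> y sequentially"
    using \<sigma>(1) by blast
qed

section \<open>Sequences in \<open>Ck\<close> and the necessity of \<open>(\<kappa>)\<close>\<close>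

lemma compactin_insert_limit:
  assumes "z \<in> topspace Z" "range f \<subseteq> topspace Z"
    and "\<And>W. openin Z W \<Longrightarrow> z \<in> W \<Longrightarrow> finite {n::nat. f n \<notin> W}"
  shows "compactin Z (insert z (range f))"
proof (rule compactin_sequence_with_limit)
  show "limitin Z f z sequentially"
    unfolding limitin_def cofinite_eq_sequentially[symmetric] eventually_cofinite
    using assms by blast
qed (use assms in auto)

text \<open>The hypothesis \<open>eq\<close> is stronger than uniform convergence on compact sets:
  on each one, almost all \<open>f n\<close> coincide with \<open>z\<close>. This settles subbasic
  sets, and finite intersections and unions preserve cofiniteness.\<close>

lemma openin_Ck_cofinite:
  assumes W: "openin (Ck Y) W" "z \<in> W" and z: "z \<in> real_cfuns Y"
    and f: "\<And>n. f n \<in> real_cfuns Y"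
    and eq: "\<And>C. compactin Y C \<Longrightarrow> finite {n::nat. \<exists>y\<in>C. f n y \<noteq> z y}"
  shows "finite {n. f n \<notin> W}"
proof -
  have "generate_topology_on {{f \<in> real_cfuns Y. f ` K \<subseteq> U} | K U. compactin Y K \<and> open U} W"
    using W(1) unfolding Ck_def by (rule openin_topology_generated_by)
  then show ?thesis
    using W(2)
  proof induction
    case (Int a b)
    then have "finite ({n. f n \<notin> a} \<union> {n. f n \<notin> b})"
      by auto
    then show ?case
      by (rule rev_finite_subset) auto
  next
    case (UN K)
    then obtain k where "k \<in> K" "finite {n. f n \<notin> k}"
      by blast
    then show ?case
      by (elim rev_finite_subset) auto
  next
    case (Basis s)
    then obtain C U where C: "compactin Y C" and s: "s = {f \<in> real_cfuns Y. f ` C \<subseteq> U}"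
      by blast
    have "{n. f n \<notin> s} \<subseteq> {n. \<exists>y\<in>C. f n y \<noteq> z y}"
      using Basis.prems f by (force simp: s)
    then show ?case
      using eq[OF C] finite_subset by blast
  qed auto
qed

text \<open>Infinitely many such indices, enumerated by \<open>r\<close>, would give open sets
  \<open>U k\<close> around \<open>A (r k)\<close> on which a member of \<open>C\<close> exceeds
  \<open>r k\<close>. A compact \<open>C\<close> is pointwise bounded, so these sets are
  point-finite, contrary to \<open>no\<close>.\<close>

lemma Cp_compact_finite_of_no_strongly_point_finite:
  assumes C: "compactin (Cp X) C"
    and A: "\<And>n. A n \<subseteq> topspace X"
    and no: "\<not> (\<exists>r::nat \<Rightarrow> nat. strict_mono r \<and> strongly_point_finite X UNIV (A \<circ> r))"
  shows "finite {n. \<exists>f\<in>C. \<forall>x\<in>A n. f x > real n}"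
proof (rule ccontr)
  assume inf: "\<not> finite {n. \<exists>f\<in>C. \<forall>x\<in>A n. f x > real n}"
  obtain r :: "nat \<Rightarrow> nat" where r: "strict_mono r" "\<And>k. r k \<in> {n. \<exists>f\<in>C. \<forall>x\<in>A n. f x > real n}"
    using infinite_enumerate[OF inf] by auto
  then have "\<forall>k. \<exists>f\<in>C. \<forall>x\<in>A (r k). f x > real (r k)"
    by blast
  then obtain f where f: "\<And>k. f k \<in> C" "\<And>k x. x \<in> A (r k) \<Longrightarrow> f k x > real (r k)"
    by metis
  have CC: "C \<subseteq> real_cfuns X"
    using compactin_subset_topspace[OF C] by (simp add: topspace_Cp)
  define U where "U k = {x \<in> topspace X. f k x \<in> {real (r k)<..}}" for k
  have "openin X (U k)" for k
    unfolding U_def using f CC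
    by (intro openin_continuous_map_preimage[of X euclideanreal]) (auto simp: real_cfuns_def)
  moreover have "A (r k) \<subseteq> U k" for k
    using f(2) A[of "r k"] by (auto simp: U_def)
  moreover have "finite {k. x \<in> U k}" if x: "x \<in> topspace X" for x
  proof -
    have "compact ((\<lambda>f. f x) ` C)"
      using image_compactin[OF C continuous_map_Cp_eval[OF x]] by simp
    then have "bounded ((\<lambda>f. f x) ` C)"
      by (rule compact_imp_bounded)
    then obtain B where B: "\<And>g. g \<in> C \<Longrightarrow> \<bar>g x\<bar> \<le> B"
      unfolding bounded_iff by auto
    have "k \<le> nat \<lceil>B\<rceil>" if "x \<in> U k" for k
    proof -
      have "real k \<le> real (r k)"
        using seq_suble[OF r(1)] by simp
      also have "\<dots> < f k x"
        using that by (simp add: U_def)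
      also have "\<dots> \<le> B"
        using B[OF f(1)] by (simp add: abs_le_iff)
      finally show ?thesis
        by linarith
    qed
    then have "{k. x \<in> U k} \<subseteq> {..nat \<lceil>B\<rceil>}"
      by auto
    then show ?thesis
      by (rule finite_subset) simp
  qed
  ultimately have "strongly_point_finite X UNIV (A \<circ> r)"
    unfolding strongly_point_finite_def point_finite_def by (intro exI[of _ U]) auto
  with no r(1) show False
    by blast
qed

lemma Ascoli_Cp_imp_property_kappa:
  assumes X: "tychonoff_space X" and Asc: "Ascoli_space (Cp X)"
  shows "property_kappa X"
  unfolding property_kappa_def
proof (intro allI impI, rule ccontr)
  fix A :: "nat \<Rightarrow> 'a set"
  assume "(\<forall>n. finite (A n) \<and> A n \<subseteq> topspace X) \<and> disjoint_family A"
  then have A: "\<And>n. finite (A n)" "\<And>n. A n \<subseteq> topspace X" and disj: "disjoint_family A"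
    by auto
  assume no: "\<nexists>r::nat \<Rightarrow> nat. strict_mono r \<and> strongly_point_finite X UNIV (A \<circ> r)"
  let ?Y = "Cp X"
  \<comment> \<open>Clipping each factor to \<open>{0..1}\<close> makes the product nonzero only if
    every factor is positive. An empty \<open>A n\<close> gives the constant 1, matching the vacuous
    condition on \<open>f\<close>.\<close>
  define \<Phi> where "\<Phi> n = (\<lambda>f\<in>real_cfuns X. \<Prod>x\<in>A n. max 0 (min 1 (f x - real n)))" for n
  \<comment> \<open>\<open>Z\<close> is the zero function on \<open>Cp X\<close>, whereas
    \<open>y0\<close> is the zero function on \<open>X\<close>, a point of
    \<open>Cp X\<close>.\<close>
  define Z where "Z = (\<lambda>f\<in>real_cfuns X. 0 :: real)"
  define y0 where "y0 = (\<lambda>x\<in>topspace X. 0 :: real)"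
  have y0: "y0 \<in> real_cfuns X"
    unfolding y0_def by (rule restrict_in_real_cfuns) simp
  have \<Phi>: "\<Phi> n \<in> real_cfuns ?Y" for n
  proof -
    have "continuous_map ?Y euclideanreal (\<lambda>f. \<Prod>x\<in>A n. max 0 (min 1 (f x - real n)))"
      using A by (intro continuous_intros continuous_map_Cp_eval) auto
    then show ?thesis
      unfolding \<Phi>_def topspace_Cp[of X, symmetric] by (rule restrict_in_real_cfuns)
  qed
  have Z: "Z \<in> real_cfuns ?Y"
    unfolding Z_def topspace_Cp[of X, symmetric] by (rule restrict_in_real_cfuns) simp
  have vanish: "finite {n. \<exists>f\<in>C. \<Phi> n f \<noteq> Z f}" if C: "compactin ?Y C" for C
  proof (rule finite_subset[OF _ Cp_compact_finite_of_no_strongly_point_finite[OF C A(2) no]])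
    have "C \<subseteq> real_cfuns X"
      using compactin_subset_topspace[OF C] by (simp add: topspace_Cp)
    moreover have "real n < f x" if "f \<in> real_cfuns X" "\<Phi> n f \<noteq> Z f" "x \<in> A n" for n f x
      using that A(1)[of n] by (auto simp: \<Phi>_def Z_def max_def split: if_splits)
    ultimately show "{n. \<exists>f\<in>C. \<Phi> n f \<noteq> Z f} \<subseteq> {n. \<exists>f\<in>C. \<forall>x\<in>A n. real n < f x}"
      by blast
  qed
  note cofinite = openin_Ck_cofinite[of ?Y _ Z \<Phi>, OF _ _ Z \<Phi> vanish]
  define \<K> where "\<K> = insert Z (range \<Phi>)"
  have "compactin (Ck ?Y) \<K>"
    unfolding \<K>_def using Z \<Phi> cofinite by (intro compactin_insert_limit) (auto simp: topspace_Ck)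
  then have "evenly_continuous ?Y \<K>"
    using Asc unfolding Ascoli_space_def by blast
  let ?P = "prod_topology (subtopology (Ck ?Y) \<K>) ?Y"
  \<comment> \<open>The evaluation is 0 at \<open>(Z, y0)\<close>; the threshold 1 is the value that
    \<open>\<Phi> n\<close> will attain inside \<open>V\<close>.\<close>
  let ?N = "{p \<in> topspace ?P. (case p of (f, y) \<Rightarrow> f y) \<in> {..<1}}"
  have "openin ?P ?N"
    using \<open>evenly_continuous ?Y \<K>\<close> unfolding evenly_continuous_def
    by (rule openin_continuous_map_preimage) simp
  moreover have "(Z, y0) \<in> ?N"
    using Z y0 by (auto simp: \<K>_def topspace_Ck topspace_Cp Z_def)
  ultimately obtain W V where W: "openin (subtopology (Ck ?Y) \<K>) W" "Z \<in> W"
    and V: "openin ?Y V" "y0 \<in> V" and WV: "W \<times> V \<subseteq> ?N"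
    unfolding openin_prod_topology_alt by meson
  obtain W' where W': "openin (Ck ?Y) W'" "W = W' \<inter> \<K>"
    using W(1) unfolding openin_subtopology by blast
  have fin1: "finite {n. \<Phi> n \<notin> W}"
    using cofinite[OF W'(1)] W(2) W' by (simp add: \<K>_def)
  obtain F where F: "finite F" "F \<subseteq> topspace X"
    "\<And>g. g \<in> real_cfuns X \<Longrightarrow> (\<And>x. x \<in> F \<Longrightarrow> g x = y0 x) \<Longrightarrow> g \<in> V"
    using openin_Cp_determined_finite[OF V] by blast
  \<comment> \<open>Disjointness enters here: each point of \<open>F\<close> lies in at most one
    \<open>A n\<close>.\<close>
  have "finite {n. A n \<inter> F \<noteq> {}}"
  proof -
    have "finite {n. x \<in> A n}" for x
    proof -
      have "m = n" if "x \<in> A m" "x \<in> A n" for m n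
        using disj that by (auto simp: disjoint_family_on_def)
      then have "{n. x \<in> A n} = {} \<or> (\<exists>m. {n. x \<in> A n} = {m})"
        by blast
      then show ?thesis
        by (metis finite.simps)
    qed
    then have "finite (\<Union>x\<in>F. {n. x \<in> A n})"
      using F by blast
    then show ?thesis
      by (rule rev_finite_subset) auto
  qed
  with fin1 have "finite ({n. \<Phi> n \<notin> W} \<union> {n. A n \<inter> F \<noteq> {}})"
    by simp
  then obtain n where "n \<notin> {n. \<Phi> n \<notin> W} \<union> {n. A n \<inter> F \<noteq> {}}"
    using ex_new_if_finite[OF infinite_UNIV_nat] by blast
  then have n: "\<Phi> n \<in> W" "A n \<inter> F = {}"
    by auto
  have "closedin X F"
    using X F by (auto simp: tychonoff_space_def closedin_Hausdorff_finite)
  then obtain \<phi> :: "'a \<Rightarrow> real" where \<phi>: "continuous_map X euclideanreal \<phi>"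
    "\<And>x. x \<in> A n \<Longrightarrow> \<phi> x = 1" "\<And>x. x \<in> F \<Longrightarrow> \<phi> x = 0"
    using tychonoff_finite_separation[OF X A _ n(2)] by blast
  \<comment> \<open>The factor \<open>n + 1\<close> makes \<open>g x - n\<close> equal to 1 on
    \<open>A n\<close>, so \<open>\<Phi> n g\<close> is 1, while \<open>g\<close> agrees with
    \<open>y0\<close> on \<open>F\<close> and thus lies in \<open>V\<close>.\<close>
  define g where "g = (\<lambda>x\<in>topspace X. (real n + 1) * \<phi> x)"
  have "continuous_map X euclideanreal (\<lambda>x. (real n + 1) * \<phi> x)"
    using \<phi>(1) by (intro continuous_intros) auto
  then have g: "g \<in> real_cfuns X"
    unfolding g_def by (rule restrict_in_real_cfuns)
  have "g \<in> V"
    using F g \<phi> by (intro F(3)) (auto simp: g_def y0_def)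
  then have "\<Phi> n g < 1"
    using WV n by auto
  moreover have "(\<Prod>x\<in>A n. max 0 (min 1 (g x - real n))) = 1"
    using A(2)[of n] \<phi> by (intro prod.neutral) (auto simp: g_def)
  ultimately show False
    using g by (simp add: \<Phi>_def)
qed

theorem corollary1p4:
  fixes X :: "'a topology"
  assumes "tychonoff_space X"
  shows "Ascoli_space (Cp X) \<longleftrightarrow> property_kappa X"
proof
  assume "Ascoli_space (Cp X)"
  then show "property_kappa X"
    using Ascoli_Cp_imp_property_kappa assms by blast
next
  assume "property_kappa X"
  then have "kappa_Frechet_Urysohn (Cp X)"
    using property_kappa_imp_kappa_Frechet_Urysohn_Cp assms by blast
  then show "Ascoli_space (Cp X)"
    unfolding Ascoli_space_def
    using tychonoff_space_Cp kappa_Frechet_Urysohn_imp_evenly_continuous by blast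
qed

end
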